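(* Let $\Theta$ be a finite parameter space partitioned into two non-empty sets $\Theta_0,\Theta_1$, let $\mathcal I$ be the set of all (coded, finite, effective) inference bases with parameter space $\Theta$, and let $Ev_{\text{p-value}}:\mathcal I\to[0,1]$ be the lower-tail likelihood-ratio $p$-value for $H_0:\theta\in\Theta_0$. Then $Ev_{\text{p-value}}$ preserves the sufficiency relation: for all $(I_1,I_2)\in S$, $Ev_{\text{p-value}}(I_1)=Ev_{\text{p-value}}(I_2)$. On the other hand, when $\Theta=\{\theta_1,\theta_2\}$ has two elements and $\Theta_0=\{\theta_1\}$, $Ev_{\text{p-value}}$ does not preserve the likelihood relation: there is $(I_1,I_2)\in L$ with $Ev_{\text{p-value}}(I_1)\ne Ev_{\text{p-value}}(I_2)$.
   Context: **Models and inference bases.** Fix the finite set $\Theta$ and work in a fixed set-theoretic universe. A statistical model $E$ consists of a finite non-empty sample space $\mathcal X_E$, a family of probability mass functions $f_{E,\theta}$ on $\mathcal X_E$ ($\theta\in\Theta$), and an injective outcome code $c_E:\mathcal X_E\to\mathbb N$, such that every outcome is effective: for each $x\in\mathcal X_E$ there is $\theta\in\Theta$ with $f_{E,\theta}(x)>0$. An inference base is a pair $I=(E,x)$ with $x\in\mathcal X_E$; $\mathcal I$ is the set of all inference bases with parameter space $\Theta$. Below $I_i=(E_i,x_i)$. **Likelihood relation.** $(I_1,I_2)\in L$ iff there is $k>0$ with $f_{E_1,\theta}(x_1)=k f_{E_2,\theta}(x_2)$ for all $\theta\in\Theta$. **Sufficiency relation.** For a surjection $T:\mathcal X_E\to\mathcal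 X_{E_T}$ (a statistic), the induced model $E_T$ has mass functions $f_{E_T,\theta}(t)=\sum_{x:T(x)=t}f_{E,\theta}(x)$. $T$ is sufficient if the conditional distribution given $T$ is free of $\theta$, i.e. there is a function $g$ on $\mathcal X_E$ with $f_{E,\theta}(x)=g(x)f_{E_T,\theta}(T(x))$ for all $x,\theta$; it is minimal sufficient if it is sufficient and is a function of every sufficient statistic. $(I_1,I_2)\in S$ iff there are minimal sufficient statistics $T_i:\mathcal X_{E_i}\to\mathcal X_{E_{T_i}}$ (surjective), $i=1,2$, and a bijection $h:\mathcal X_{E_{T_2}}\to\mathcal X_{E_{T_1}}$ with $f_{E_{T_1},\theta}(h(t))=f_{E_{T_2},\theta}(t)$ for all $\theta\in\Theta$, $t\in\mathcal X_{E_{T_2}}$, and $T_1(x_1)=h(T_2(x_2))$. **The $p$-value.** For $z\in\mathcal X_E$ let $$\operatorname{LR}(E,z,\Theta_0)=\frac{\max_{\theta\in\Theta_0}f_{E,\theta}(z)}{\max_{\theta\in\Theta_1}f_{E,\theta}(z)}\in[0,\infty],$$ with $a/0=\infty$ for $a>0$ and $0/0=0$. Put $A_x=\{y\in\mathcal X_E:\operatorname{LR}(E,y,\Theta_0)\le\operatorname{LR}(E,x,\Theta_0)\}$ and $$Ev_{\text{p-value}}(E,x)=\max_{\theta\in\Theta_0}\sum_{y\in A_x}f_{E,\theta}(y).$$ *)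

theory Defs
  imports "HOL-Probability.Probability" "HOL-Library.Infinite_Typeclass"
begin

text \<open>
  The type \<open>'u\<close> plays the role of the fixed universe from which all sample spaces, including
  the ranges of statistics, are taken; it is required to be infinite where results are stated, so
  that every finite set has a copy in it.  The parameter space is an explicit set \<open>\<Theta>\<close>
  of elements of \<open>'p\<close>.  The fields of a model are relevant only for parameters in
  \<open>\<Theta>\<close> and outcomes in the sample space.
\<close>

record ('p, 'u) stat_model =
  sample_space :: "'u set"
  law :: "'p \<Rightarrow> 'u pmf"
  outcome_code :: "'u \<Rightarrow> nat"

type_synonym ('p, 'u) inference_base = "('p, 'u) stat_model \<times> 'u"

abbreviation mass :: "('p, 'u) stat_model \<Rightarrow> 'p \<Rightarrow> 'u \<Rightarrow> real" where
  "mass E \<theta> x \<equiv> pmf (law E \<theta>) x"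

definition is_model :: "'p set \<Rightarrow> ('p, 'u) stat_model \<Rightarrow> bool" where
  "is_model \<Theta> E \<longleftrightarrow>
     finite (sample_space E) \<and> sample_space E \<noteq> {} \<and>
     (\<forall>\<theta>\<in>\<Theta>. set_pmf (law E \<theta>) \<subseteq> sample_space E) \<and>
     inj_on (outcome_code E) (sample_space E) \<and>
     (\<forall>x\<in>sample_space E. \<exists>\<theta>\<in>\<Theta>. mass E \<theta> x > 0)"

definition inference_bases :: "'p set \<Rightarrow> ('p, 'u) inference_base set" where
  "inference_bases \<Theta> = {(E, x). is_model \<Theta> E \<and> x \<in> sample_space E}"

definition likelihood_rel :: "'p set \<Rightarrow> ('p, 'u) inference_base rel" where
  "likelihood_rel \<Theta> =
     {((E1, x1), (E2, x2)).
        (E1, x1) \<in> inference_bases \<Theta> \<and> (E2, x2) \<in> inference_bases \<Theta> \<and>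
        (\<exists>k>0. \<forall>\<theta>\<in>\<Theta>. mass E1 \<theta> x1 = k * mass E2 \<theta> x2)}"

text \<open>
  A statistic on \<open>E\<close> is a function on its sample space, taken as a surjection onto its
  image.  The outcome code of the induced model is an arbitrary one, since nothing depends on it.
\<close>

definition induced_model ::
  "('p, 'u) stat_model \<Rightarrow> ('u \<Rightarrow> 'u) \<Rightarrow> ('p, 'u) stat_model" where
  "induced_model E T =
     \<lparr>sample_space = T ` sample_space E,
      law = (\<lambda>\<theta>. map_pmf T (law E \<theta>)),
      outcome_code = (SOME c. inj_on c (T ` sample_space E))\<rparr>"

lemma mass_induced_model:
  assumes "is_model \<Theta> E" "\<theta> \<in> \<Theta>"
  shows "mass (induced_model E T) \<theta> t = (\<Sum>x | x \<in> sample_space E \<and> T x = t. mass E \<theta> x)"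
proof -
  have fin: "finite (sample_space E)" and sub: "set_pmf (law E \<theta>) \<subseteq> sample_space E"
    using assms by (auto simp: is_model_def)
  have "mass (induced_model E T) \<theta> t = measure (measure_pmf (law E \<theta>)) (T -` {t})"
    by (simp add: induced_model_def pmf_map)
  also have "\<dots> = measure (measure_pmf (law E \<theta>)) {x. x \<in> sample_space E \<and> T x = t}"
    by (rule measure_eq_AE) (use sub in \<open>auto simp: AE_measure_pmf_iff\<close>)
  also have "\<dots> = (\<Sum>x | x \<in> sample_space E \<and> T x = t. mass E \<theta> x)"
    using fin by (intro measure_measure_pmf_finite) auto
  finally show ?thesis .
qed

lemma is_model_induced_model:
  fixes E :: "('p, 'u) stat_model" and T :: "'u \<Rightarrow> 'u"
  assumes "is_model \<Theta> E"
  shows "is_model \<Theta> (induced_model E T)"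
proof -
  have fin: "finite (sample_space E)"
    using assms by (simp add: is_model_def)
  then obtain c :: "'u \<Rightarrow> nat" where "inj_on c (T ` sample_space E)"
    using finite_imp_inj_to_nat_seg[of "T ` sample_space E"] by auto
  then have "inj_on (SOME c :: 'u \<Rightarrow> nat. inj_on c (T ` sample_space E)) (T ` sample_space E)"
    by (rule someI[where P = "\<lambda>c. inj_on c (T ` sample_space E)"])
  moreover have "\<exists>\<theta>\<in>\<Theta>. pmf (map_pmf T (law E \<theta>)) (T x) > 0" if "x \<in> sample_space E" for x
  proof -
    have "\<forall>x\<in>sample_space E. \<exists>\<theta>\<in>\<Theta>. mass E \<theta> x > 0"
      using assms by (simp add: is_model_def)
    with that obtain \<theta> where "\<theta> \<in> \<Theta>" "mass E \<theta> x > 0"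
      by blast
    then have "x \<in> set_pmf (law E \<theta>)"
      by (simp add: set_pmf_iff)
    then have "T x \<in> set_pmf (map_pmf T (law E \<theta>))"
      by simp
    with \<open>\<theta> \<in> \<Theta>\<close> show ?thesis
      by (meson pmf_positive)
  qed
  ultimately show ?thesis
    using assms unfolding is_model_def induced_model_def by (simp add: image_mono)
qed

definition sufficient :: "'p set \<Rightarrow> ('p, 'u) stat_model \<Rightarrow> ('u \<Rightarrow> 'u) \<Rightarrow> bool" where
  "sufficient \<Theta> E T \<longleftrightarrow>
     (\<exists>g :: 'u \<Rightarrow> real. \<forall>x\<in>sample_space E. \<forall>\<theta>\<in>\<Theta>.
        mass E \<theta> x = g x * mass (induced_model E T) \<theta> (T x))"

definition minimal_sufficient ::
  "'p set \<Rightarrow> ('p, 'u) stat_model \<Rightarrow> ('u \<Rightarrow> 'u) \<Rightarrow> bool" where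
  "minimal_sufficient \<Theta> E T \<longleftrightarrow>
     sufficient \<Theta> E T \<and>
     (\<forall>T'. sufficient \<Theta> E T' \<longrightarrow> (\<exists>\<phi>. \<forall>x\<in>sample_space E. T x = \<phi> (T' x)))"

definition sufficiency_rel :: "'p set \<Rightarrow> ('p, 'u) inference_base rel" where
  "sufficiency_rel \<Theta> =
     {((E1, x1), (E2, x2)).
        (E1, x1) \<in> inference_bases \<Theta> \<and> (E2, x2) \<in> inference_bases \<Theta> \<and>
        (\<exists>T1 T2 h.
           minimal_sufficient \<Theta> E1 T1 \<and> minimal_sufficient \<Theta> E2 T2 \<and>
           bij_betw h (sample_space (induced_model E2 T2)) (sample_space (induced_model E1 T1)) \<and>
           (\<forall>\<theta>\<in>\<Theta>. \<forall>t\<in>sample_space (induced_model E2 T2).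
              mass (induced_model E1 T1) \<theta> (h t) = mass (induced_model E2 T2) \<theta> t) \<and>
           T1 x1 = h (T2 x2))}"

text \<open>
  Division on \<^typ>\<open>ennreal\<close> follows exactly the conventions needed for the likelihood ratio:
  \<open>a / 0 = \<infinity>\<close> for \<open>a > 0\<close>, and \<open>0 / 0 = 0\<close>.
\<close>

definition LR :: "'p set \<Rightarrow> 'p set \<Rightarrow> ('p, 'u) stat_model \<Rightarrow> 'u \<Rightarrow> ennreal" where
  "LR \<Theta>0 \<Theta>1 E z =
     ennreal (MAX \<theta>\<in>\<Theta>0. mass E \<theta> z) / ennreal (MAX \<theta>\<in>\<Theta>1. mass E \<theta> z)"

definition lower_tail ::
  "'p set \<Rightarrow> 'p set \<Rightarrow> ('p, 'u) stat_model \<Rightarrow> 'u \<Rightarrow> 'u set" where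
  "lower_tail \<Theta>0 \<Theta>1 E x = {y \<in> sample_space E. LR \<Theta>0 \<Theta>1 E y \<le> LR \<Theta>0 \<Theta>1 E x}"

definition Ev_pvalue :: "'p set \<Rightarrow> 'p set \<Rightarrow> ('p, 'u) inference_base \<Rightarrow> real" where
  "Ev_pvalue \<Theta>0 \<Theta>1 =
     (\<lambda>(E, x). MAX \<theta>\<in>\<Theta>0. \<Sum>y\<in>lower_tail \<Theta>0 \<Theta>1 E x. mass E \<theta> y)"

end

theory Submission
  imports Defs
begin

text \<open>
  The \<^emph>\<open>p\<close>-value is the probability of a set of outcomes that is cut out by the
  likelihood ratio alone, and the likelihood ratio of an outcome does not change when its likelihood function is multiplied by a
  positive constant (\<open>LR_proportional\<close>).  For a sufficient statistic \<open>T\<close> the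
  factorisation \<open>f(x) = g(x) f_T(T x)\<close> says that \<open>x\<close> and \<open>T x\<close> have proportional
  likelihoods; effectiveness forces \<open>g(x) > 0\<close>.  Hence the lower tail at \<open>x\<close> is the full
  preimage under \<open>T\<close> of the lower tail at \<open>T x\<close>, and the two tails have the same
  probability under every parameter.  So passing to the induced model preserves the
  \<^emph>\<open>p\<close>-value, and so does the bijection matching two induced models: both are maps that
  push the laws forward and respect likelihoods up to a positive factor
  (\<open>Ev_pvalue_transport\<close>).  Going from \<open>I1\<close> to its induced model, across the bijection and
  back to \<open>I2\<close> gives invariance under the sufficiency relation.

  The likelihood relation ignores the probabilities of the outcomes that were not observed, whereas
  the tail probability does not.  Take two outcomes, the first of which has probability \<open>q\<close>
  under the null and \<open>2 * q\<close> under the alternative, with \<open>0 < q < 1/2\<close>.  The likelihood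
  functions of the first outcome are proportional for all values of \<open>q\<close>, but its lower tail
  contains nothing else, so its \<^emph>\<open>p\<close>-value is \<open>q\<close> (\<open>Ev_pvalue_two_point_model\<close>).
\<close>

section \<open>Invariance of the likelihood ratio and transport of the p-value\<close>

lemma ennreal_divide_cancel_left:
  fixes k a b :: real
  assumes "k > 0" "a \<ge> 0" "b \<ge> 0"
  shows "ennreal (k * a) / ennreal (k * b) = ennreal a / ennreal b"
proof (cases "b = 0")
  case True
  then show ?thesis
    using assms by (cases "a = 0") (auto simp: ennreal_divide_zero)
next
  case False
  then show ?thesis
    using assms by (simp add: divide_ennreal)
qed

lemma LR_proportional:
  assumes fin: "finite \<Theta>0" "finite \<Theta>1" and ne: "\<Theta>0 \<noteq> {}" "\<Theta>1 \<noteq> {}"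
    and k: "k > 0"
    and scale: "\<And>\<theta>. \<theta> \<in> \<Theta>0 \<union> \<Theta>1 \<Longrightarrow> mass E \<theta> z = k * mass E' \<theta> z'"
  shows "LR \<Theta>0 \<Theta>1 E z = LR \<Theta>0 \<Theta>1 E' z'"
proof -
  have max: "(MAX \<theta>\<in>A. mass E \<theta> z) = k * (MAX \<theta>\<in>A. mass E' \<theta> z')
      \<and> (MAX \<theta>\<in>A. mass E' \<theta> z') \<ge> 0"
    if A: "finite A" "A \<noteq> {}" "A \<subseteq> \<Theta>0 \<union> \<Theta>1" for A
  proof
    have "mono (\<lambda>u. k * u)"
      using k by (auto intro!: monoI)
    then have "k * (MAX \<theta>\<in>A. mass E' \<theta> z') = Max ((\<lambda>u. k * u) ` (\<lambda>\<theta>. mass E' \<theta> z') ` A)"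
      using A by (intro mono_Max_commute) auto
    also have "(\<lambda>u. k * u) ` (\<lambda>\<theta>. mass E' \<theta> z') ` A = (\<lambda>\<theta>. mass E \<theta> z) ` A"
      unfolding image_image using A(3) scale by (intro image_cong) auto
    finally show "(MAX \<theta>\<in>A. mass E \<theta> z) = k * (MAX \<theta>\<in>A. mass E' \<theta> z')" ..
    show "(MAX \<theta>\<in>A. mass E' \<theta> z') \<ge> 0"
      using A by (auto simp: Max_ge_iff)
  qed
  show ?thesis
    unfolding LR_def using max[of \<Theta>0] max[of \<Theta>1] fin ne k
    by (simp add: ennreal_divide_cancel_left)
qed

text \<open>
  A map that respects likelihoods up to positive factors preserves likelihood ratios, so lower tails
  are unions of its fibres; if it also pushes the laws forward, summing over fibres shows that tail
  probabilities agree.  The positive factor may vary with the outcome, as only ratios enter.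
\<close>

lemma Ev_pvalue_transport:
  assumes fin: "finite \<Theta>0" "finite \<Theta>1" and ne: "\<Theta>0 \<noteq> {}" "\<Theta>1 \<noteq> {}"
    and X: "finite (sample_space E)" "T ` sample_space E = sample_space E'"
    and g: "\<And>y. y \<in> sample_space E \<Longrightarrow> g y > 0"
    and scale: "\<And>y \<theta>. y \<in> sample_space E \<Longrightarrow> \<theta> \<in> \<Theta>0 \<union> \<Theta>1 \<Longrightarrow>
      mass E \<theta> y = g y * mass E' \<theta> (T y)"
    and push: "\<And>t \<theta>. t \<in> sample_space E' \<Longrightarrow> \<theta> \<in> \<Theta>0 \<Longrightarrow>
      mass E' \<theta> t = (\<Sum>y | y \<in> sample_space E \<and> T y = t. mass E \<theta> y)"
    and x: "x \<in> sample_space E"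
  shows "Ev_pvalue \<Theta>0 \<Theta>1 (E, x) = Ev_pvalue \<Theta>0 \<Theta>1 (E', T x)"
proof -
  let ?A = "lower_tail \<Theta>0 \<Theta>1 E x" and ?B = "lower_tail \<Theta>0 \<Theta>1 E' (T x)"
  have LR: "LR \<Theta>0 \<Theta>1 E y = LR \<Theta>0 \<Theta>1 E' (T y)" if "y \<in> sample_space E" for y
    using fin ne g[OF that] scale[OF that] by (intro LR_proportional) auto
  have A: "?A = {y \<in> sample_space E. T y \<in> ?B}"
    unfolding lower_tail_def using LR x X(2) by auto
  have finAB: "finite ?A" "finite ?B"
    using X(1) finite_imageI[OF X(1), of T] X(2) by (auto simp: lower_tail_def)
  have "(\<Sum>y\<in>?A. mass E \<theta> y) = (\<Sum>t\<in>?B. mass E' \<theta> t)" if \<theta>: "\<theta> \<in> \<Theta>0" for \<theta>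
  proof -
    have "(\<Sum>y\<in>?A. mass E \<theta> y) = (\<Sum>t\<in>?B. \<Sum>y | y \<in> ?A \<and> T y = t. mass E \<theta> y)"
      using finAB A by (intro sum.group[symmetric]) auto
    also have "\<dots> = (\<Sum>t\<in>?B. mass E' \<theta> t)"
    proof (rule sum.cong)
      fix t assume t: "t \<in> ?B"
      then have "{y. y \<in> ?A \<and> T y = t} = {y. y \<in> sample_space E \<and> T y = t}"
        using A by auto
      with t \<theta> show "(\<Sum>y | y \<in> ?A \<and> T y = t. mass E \<theta> y) = mass E' \<theta> t"
        using push[of t \<theta>] by (simp add: lower_tail_def)
    qed simp
    finally show ?thesis .
  qed
  then show ?thesis
    by (simp add: Ev_pvalue_def cong: image_cong_simp)
qed

lemma Ev_pvalue_bounds: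
  assumes "finite \<Theta>0" "\<Theta>0 \<noteq> {}" "finite (sample_space E)"
  shows "Ev_pvalue \<Theta>0 \<Theta>1 (E, x) \<in> {0..1}"
proof -
  let ?A = "lower_tail \<Theta>0 \<Theta>1 E x"
  have "finite ?A"
    using assms(3) by (simp add: lower_tail_def)
  then have "(\<Sum>y\<in>?A. mass E \<theta> y) \<in> {0..1}" for \<theta>
    by (simp flip: measure_measure_pmf_finite)
  moreover have "Ev_pvalue \<Theta>0 \<Theta>1 (E, x) \<in> (\<lambda>\<theta>. \<Sum>y\<in>?A. mass E \<theta> y) ` \<Theta>0"
    unfolding Ev_pvalue_def prod.case using assms by (intro Max_in) auto
  ultimately show ?thesis
    by auto
qed

section \<open>The sufficiency relation\<close>

lemma Ev_pvalue_induced_model: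
  assumes fin: "finite \<Theta>0" "finite \<Theta>1" and ne: "\<Theta>0 \<noteq> {}" "\<Theta>1 \<noteq> {}"
    and E: "is_model (\<Theta>0 \<union> \<Theta>1) E" and suff: "sufficient (\<Theta>0 \<union> \<Theta>1) E T"
    and x: "x \<in> sample_space E"
  shows "Ev_pvalue \<Theta>0 \<Theta>1 (E, x) = Ev_pvalue \<Theta>0 \<Theta>1 (induced_model E T, T x)"
proof -
  obtain g :: "'b \<Rightarrow> real" where g: "\<And>y \<theta>. y \<in> sample_space E \<Longrightarrow> \<theta> \<in> \<Theta>0 \<union> \<Theta>1 \<Longrightarrow>
      mass E \<theta> y = g y * mass (induced_model E T) \<theta> (T y)"
    using suff unfolding sufficient_def by blast
  have gpos: "g y > 0" if y: "y \<in> sample_space E" for y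
  proof -
    \<comment> \<open>Effectiveness: an outcome that is impossible under every parameter could have \<open>g y = 0\<close>.\<close>
    obtain \<theta> where "\<theta> \<in> \<Theta>0 \<union> \<Theta>1" "mass E \<theta> y > 0"
      using E y unfolding is_model_def by blast
    then show ?thesis
      using g[OF y] by (metis pmf_nonneg zero_less_mult_pos2 mult_zero_right order_le_less)
  qed
  show ?thesis
    using E g gpos x
    by (intro Ev_pvalue_transport[OF fin ne, where g = g] mass_induced_model[OF E])
      (auto simp: is_model_def induced_model_def)
qed

lemma Ev_pvalue_sufficiency_rel:
  assumes fin: "finite \<Theta>0" "finite \<Theta>1" and ne: "\<Theta>0 \<noteq> {}" "\<Theta>1 \<noteq> {}"
    and S: "((E1, x1), (E2, x2)) \<in> sufficiency_rel (\<Theta>0 \<union> \<Theta>1)"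
  shows "Ev_pvalue \<Theta>0 \<Theta>1 (E1, x1) = Ev_pvalue \<Theta>0 \<Theta>1 (E2, x2)"
proof -
  obtain T1 T2 h where E: "is_model (\<Theta>0 \<union> \<Theta>1) E1" "is_model (\<Theta>0 \<union> \<Theta>1) E2"
    and x: "x1 \<in> sample_space E1" "x2 \<in> sample_space E2"
    and T: "sufficient (\<Theta>0 \<union> \<Theta>1) E1 T1" "sufficient (\<Theta>0 \<union> \<Theta>1) E2 T2"
    and h: "bij_betw h (sample_space (induced_model E2 T2)) (sample_space (induced_model E1 T1))"
    and eq: "\<And>\<theta> t. \<theta> \<in> \<Theta>0 \<union> \<Theta>1 \<Longrightarrow> t \<in> sample_space (induced_model E2 T2) \<Longrightarrow>
      mass (induced_model E1 T1) \<theta> (h t) = mass (induced_model E2 T2) \<theta> t"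
    and hx: "T1 x1 = h (T2 x2)"
    using S unfolding sufficiency_rel_def inference_bases_def minimal_sufficient_def by auto
  let ?F1 = "induced_model E1 T1" and ?F2 = "induced_model E2 T2"
  have "finite (sample_space ?F2)" "T2 x2 \<in> sample_space ?F2"
    using E(2) x(2) by (auto simp: is_model_def induced_model_def)
  moreover have "mass ?F1 \<theta> t = (\<Sum>s | s \<in> sample_space ?F2 \<and> h s = t. mass ?F2 \<theta> s)"
    if t: "t \<in> sample_space ?F1" and \<theta>: "\<theta> \<in> \<Theta>0" for t \<theta>
  proof -
    obtain s where s: "s \<in> sample_space ?F2" "h s = t"
      using t unfolding bij_betw_imp_surj_on[OF h, symmetric] by blast
    then have "{s. s \<in> sample_space ?F2 \<and> h s = t} = {s}"
      using h by (auto simp: bij_betw_def inj_on_def)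
    with s \<theta> show ?thesis
      using eq[of \<theta> s] by simp
  qed
  ultimately have "Ev_pvalue \<Theta>0 \<Theta>1 (?F2, T2 x2) = Ev_pvalue \<Theta>0 \<Theta>1 (?F1, h (T2 x2))"
    using h eq
    by (intro Ev_pvalue_transport[OF fin ne, where g = "\<lambda>_. 1"]) (auto simp: bij_betw_def)
  then show ?thesis
    using Ev_pvalue_induced_model[OF fin ne E(1) T(1) x(1)]
      Ev_pvalue_induced_model[OF fin ne E(2) T(2) x(2)] hx by simp
qed

section \<open>The likelihood relation\<close>

definition two_point_model :: "'u \<Rightarrow> 'u \<Rightarrow> ('p \<Rightarrow> real) \<Rightarrow> ('p, 'u) stat_model" where
  "two_point_model a b p =
     \<lparr>sample_space = {a, b},
      law = (\<lambda>\<theta>. map_pmf (\<lambda>c. if c then a else b) (bernoulli_pmf (p \<theta>))),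
      outcome_code = (\<lambda>x. if x = a then 0 else 1)\<rparr>"

lemma mass_two_point_model:
  assumes "a \<noteq> b" "0 \<le> p \<theta>" "p \<theta> \<le> 1"
  shows "mass (two_point_model a b p) \<theta> a = p \<theta>"
    and "mass (two_point_model a b p) \<theta> b = 1 - p \<theta>"
proof -
  have "(\<lambda>c. if c then a else b) -` {a} = {True}" "(\<lambda>c. if c then a else b) -` {b} = {False}"
    using assms(1) by (auto split: if_splits)
  then show "mass (two_point_model a b p) \<theta> a = p \<theta>"
    and "mass (two_point_model a b p) \<theta> b = 1 - p \<theta>"
    using assms by (simp_all add: two_point_model_def pmf_map measure_pmf_single)
qed

lemma is_model_two_point_model:
  assumes "a \<noteq> b" "\<theta> \<in> \<Theta>" "0 < p \<theta>" "p \<theta> < 1"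
  shows "is_model \<Theta> (two_point_model a b p)"
proof -
  have "mass (two_point_model a b p) \<theta> a > 0" "mass (two_point_model a b p) \<theta> b > 0"
    using assms by (simp_all add: mass_two_point_model)
  then show ?thesis
    using assms(1,2) by (auto simp: is_model_def two_point_model_def inj_on_def)
qed

text \<open>
  The bound \<open>q < 1/2\<close> makes the ratio at \<open>b\<close>, which is \<open>(1 - q) / (1 - 2 * q)\<close>,
  finite; it exceeds \<open>1\<close>, while the ratio at \<open>a\<close> is \<open>1/2\<close>.
\<close>

lemma Ev_pvalue_two_point_model:
  assumes ab: "a \<noteq> b" and q: "0 < q" "q < 1/2" and p: "p \<theta>1 = q" "p \<theta>2 = 2 * q"
  shows "Ev_pvalue {\<theta>1} {\<theta>2} (two_point_model a b p, a) = q"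
proof -
  let ?E = "two_point_model a b p"
  have mass: "mass ?E \<theta>1 a = q" "mass ?E \<theta>1 b = 1 - q"
      "mass ?E \<theta>2 a = 2 * q" "mass ?E \<theta>2 b = 1 - 2 * q"
    using mass_two_point_model[OF ab, of p \<theta>1] mass_two_point_model[OF ab, of p \<theta>2] p q by auto
  have "LR {\<theta>1} {\<theta>2} ?E a = ennreal (1/2)" "LR {\<theta>1} {\<theta>2} ?E b = ennreal ((1 - q) / (1 - 2 * q))"
    unfolding LR_def using q by (simp_all add: mass divide_ennreal)
  moreover have "1/2 < (1 - q) / (1 - 2 * q)"
    using q by (simp add: field_simps)
  ultimately have "LR {\<theta>1} {\<theta>2} ?E a < LR {\<theta>1} {\<theta>2} ?E b"
    by (simp only: ennreal_less_iff)
  then have "lower_tail {\<theta>1} {\<theta>2} ?E a = {a}"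
    by (auto simp: lower_tail_def two_point_model_def)
  then show ?thesis
    by (simp add: Ev_pvalue_def mass)
qed

lemma Ev_pvalue_not_likelihood_invariant:
  fixes \<theta>1 \<theta>2 :: 'p
  assumes "\<theta>1 \<noteq> \<theta>2"
  shows "\<exists>(I1, I2) \<in> (likelihood_rel {\<theta>1, \<theta>2} :: ('p, 'u::infinite) inference_base rel).
    Ev_pvalue {\<theta>1} {\<theta>2} I1 \<noteq> Ev_pvalue {\<theta>1} {\<theta>2} I2"
proof -
  obtain a b :: 'u where ab: "a \<noteq> b"
    using ex_new_if_finite[OF infinite_UNIV, of "{undefined}"] by auto
  define p where "p q \<theta> = (if \<theta> = \<theta>1 then q else 2 * q)" for q :: real and \<theta>
  define E where "E q = two_point_model a b (p q)" for q
  have p: "p q \<theta>1 = q" "p q \<theta>2 = 2 * q" for q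
    using assms by (auto simp: p_def)
  have val: "Ev_pvalue {\<theta>1} {\<theta>2} (E q, a) = q" if "0 < q" "q < 1/2" for q
    unfolding E_def using Ev_pvalue_two_point_model[OF ab that, of "p q"] p by simp
  have base: "(E q, a) \<in> inference_bases {\<theta>1, \<theta>2}" if "0 < q" "q < 1/2" for q
    using is_model_two_point_model[OF ab, of \<theta>1 "{\<theta>1, \<theta>2}" "p q"] that p
    by (simp add: inference_bases_def E_def two_point_model_def)
  have lik: "mass (E q) \<theta> a = p q \<theta>" if "0 < q" "q < 1/2" for q \<theta>
    unfolding E_def using that by (intro mass_two_point_model[OF ab]) (auto simp: p_def)
  have "\<forall>\<theta>\<in>{\<theta>1, \<theta>2}. mass (E (1/4)) \<theta> a = 3/4 * mass (E (1/3)) \<theta> a"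
    using p by (simp add: lik)
  then have "((E (1/4), a), (E (1/3), a)) \<in> likelihood_rel {\<theta>1, \<theta>2}"
    using base[of "1/4"] base[of "1/3"]
    by (auto simp: likelihood_rel_def intro!: exI[of _ "3/4 :: real"])
  moreover have "Ev_pvalue {\<theta>1} {\<theta>2} (E (1/4), a) \<noteq> Ev_pvalue {\<theta>1} {\<theta>2} (E (1/3), a)"
    by (simp add: val)
  ultimately show ?thesis
    by blast
qed

theorem mainTheorem3:
  fixes \<Theta> \<Theta>0 \<Theta>1 :: "'p set"
  assumes "finite \<Theta>"
    and "\<Theta>0 \<union> \<Theta>1 = \<Theta>" and "\<Theta>0 \<inter> \<Theta>1 = {}"
    and "\<Theta>0 \<noteq> {}" and "\<Theta>1 \<noteq> {}"
  shows "Ev_pvalue \<Theta>0 \<Theta>1 \<in> (inference_bases \<Theta> :: ('p, 'u::infinite) inference_base set) \<rightarrow> {0..1}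
    \<and> (\<forall>(I1, I2) \<in> (sufficiency_rel \<Theta> :: ('p, 'u) inference_base rel).
          Ev_pvalue \<Theta>0 \<Theta>1 I1 = Ev_pvalue \<Theta>0 \<Theta>1 I2)
    \<and> (\<forall>\<theta>1 \<theta>2. \<theta>1 \<noteq> \<theta>2 \<and> \<Theta> = {\<theta>1, \<theta>2} \<and> \<Theta>0 = {\<theta>1} \<longrightarrow>
          (\<exists>(I1, I2) \<in> (likelihood_rel \<Theta> :: ('p, 'u) inference_base rel).
             Ev_pvalue \<Theta>0 \<Theta>1 I1 \<noteq> Ev_pvalue \<Theta>0 \<Theta>1 I2))"
proof (intro conjI)
  have fin: "finite \<Theta>0" "finite \<Theta>1"
    using assms(1,2) by (auto intro: finite_subset)
  show "Ev_pvalue \<Theta>0 \<Theta>1 \<in> (inference_bases \<Theta> :: ('p, 'u) inference_base set) \<rightarrow> {0..1}"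
    using Ev_pvalue_bounds[OF fin(1) assms(4)]
    by (force simp: inference_bases_def is_model_def)
  show "\<forall>(I1, I2) \<in> (sufficiency_rel \<Theta> :: ('p, 'u) inference_base rel).
      Ev_pvalue \<Theta>0 \<Theta>1 I1 = Ev_pvalue \<Theta>0 \<Theta>1 I2"
    using Ev_pvalue_sufficiency_rel[OF fin assms(4,5)] unfolding assms(2) by auto
  show "\<forall>\<theta>1 \<theta>2. \<theta>1 \<noteq> \<theta>2 \<and> \<Theta> = {\<theta>1, \<theta>2} \<and> \<Theta>0 = {\<theta>1} \<longrightarrow>
      (\<exists>(I1, I2) \<in> (likelihood_rel \<Theta> :: ('p, 'u) inference_base rel).
         Ev_pvalue \<Theta>0 \<Theta>1 I1 \<noteq> Ev_pvalue \<Theta>0 \<Theta>1 I2)"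
  proof (intro allI impI)
    fix \<theta>1 \<theta>2
    assume \<theta>: "\<theta>1 \<noteq> \<theta>2 \<and> \<Theta> = {\<theta>1, \<theta>2} \<and> \<Theta>0 = {\<theta>1}"
    then have "\<Theta>1 = {\<theta>2}"
      using assms(2,3,5) by auto
    with \<theta> show "\<exists>(I1, I2) \<in> (likelihood_rel \<Theta> :: ('p, 'u) inference_base rel).
        Ev_pvalue \<Theta>0 \<Theta>1 I1 \<noteq> Ev_pvalue \<Theta>0 \<Theta>1 I2"
      using Ev_pvalue_not_likelihood_invariant[of \<theta>1 \<theta>2] by simp
  qed
qed

end
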